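(* Let $H=(H^\bullet,H^\times)$ be a hypergraph and $\mathcal{H}$ the set of its subhypergraphs. For $\lambda\in\mathbb{N}$ write $\lambda=2i+j$ with $j\in\{0,1\}$ and define on $\mathcal{H}$ $[\gamma,\Gamma]_{\lambda/2}=[\delta,\Delta]^i\circ([\gamma,\Gamma]_{1/2})^j\circ[\epsilon,\varepsilon]^i$ and $[\phi,\Phi]_{\lambda/2}=[\epsilon,\varepsilon]^i\circ([\phi,\Phi]_{1/2})^j\circ[\delta,\Delta]^i$. Then (a) $\{[\gamma,\Gamma]_{\lambda/2}\mid\lambda\in\mathbb{N}\}$ is a granulometry: each $[\gamma,\Gamma]_{\lambda/2}$ is an opening on $\mathcal{H}$, and for all $\lambda\le\mu$ in $\mathbb{N}$ and all $X\in\mathcal{H}$, $[\gamma,\Gamma]_{\mu/2}(X)\subseteq[\gamma,\Gamma]_{\lambda/2}(X)$; and (b) $\{[\phi,\Phi]_{\lambda/2}\mid\lambda\in\mathbb{N}\}$ is the dual (closing) granulometry: each $[\phi,\Phi]_{\lambda/2}$ is a closing on $\mathcal{H}$, and for all $\lambda\le\mu$ and all $X\in\mathcal{H}$, $[\phi,\Phi]_{\lambda/2}(X)\subseteq[\phi,\Phi]_{\mu/2}(X)$.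
   Context: A hypergraph is a pair $H=(H^\bullet,H^\times)$ where $H^\bullet$ is a set of vertices and $H^\times=(e_i)_{i\in I}$ is a family of hyperedges indexed by a finite set $I$, each with vertex set $v(e)\subseteq H^\bullet$. Subsets of $H^\times$ are subfamilies $X^\times=(e_j)_{j\in J}$, $J\subseteq I$. A subhypergraph is $X=(X^\bullet,X^\times)$ with $X^\bullet\subseteq H^\bullet$, $X^\times\subseteq H^\times$, $v(e)\subseteq X^\bullet$ for all $e\in X^\times$; inclusion is componentwise. Operators: $\delta^\bullet(X^\times)=\bigcup_{j\in J}v(e_j)$; $\epsilon^\bullet(X^\times)=\bigcap_{i\in I\setminus J}\overline{v(e_i)}$; $\epsilon^\times(X^\bullet)=\{e_i\mid v(e_i)\subseteq X^\bullet\}$; $\delta^\times(X^\bullet)=\{e_i\mid v(e_i)\cap X^\bullet\neq\emptyset\}$; $\delta=\delta^\bullet\circ\delta^\times$, $\epsilon=\epsilon^\bullet\circ\epsilon^\times$; $\Delta=\delta^\times\circ\delta^\bullet$, $\varepsilon=\epsilon^\times\circ\epsilon^\bullet$; $[\delta,\Delta](X)=(\delta(X^\bullet),\Delta(X^\times))$, $[\epsilon,\varepsilon](X)=(\epsilon(X^\bullet),\varepsilon(X^\times))$; $[\gamma,\Gamma]_{1/2}(X)=(\delta^\bullet\epsilon^\times(X^\bullet),\delta^\times\epsilon^\bullet(X^\times))$ and $[\phi,\Phi]_{1/2}(X)=(\epsilon^\bullet\delta^\times(X^\bullet),\epsilon^\times\delta^\bullet(X^\times))$. Powers denote iterated composition,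 with the $0$-th power the identity. An opening is an increasing, idempotent, anti-extensive operator; a closing is increasing, idempotent, extensive. *)

theory Defs
  imports Main "HOL-Library.FuncSet" "HOL-Library.Product_Order"
begin

text \<open>Hyperedges form a family, so a set of hyperedges is represented by its set of indices.
  A pair \<open>(X\<^sup>\<bullet>, X\<^sup>\<times>)\<close> has type \<open>'v set \<times> 'e set\<close>, and componentwise inclusion is the
  product order \<open>\<le>\<close>.\<close>

record ('v, 'e) hypergraph =
  verts :: "'v set"
  edges :: "'e set"
  ends  :: "'e \<Rightarrow> 'v set"

definition is_hypergraph :: "('v, 'e) hypergraph \<Rightarrow> bool" where
  "is_hypergraph H \<longleftrightarrow> finite (edges H) \<and> (\<forall>e\<in>edges H. ends H e \<subseteq> verts H)"

definition subhypergraphs :: "('v, 'e) hypergraph \<Rightarrow> ('v set \<times> 'e set) set" where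
  "subhypergraphs H =
     {(V, E). V \<subseteq> verts H \<and> E \<subseteq> edges H \<and> (\<forall>e\<in>E. ends H e \<subseteq> V)}"

definition dil_v :: "('v, 'e) hypergraph \<Rightarrow> 'e set \<Rightarrow> 'v set" where
  "dil_v H E = (\<Union>e\<in>E. ends H e)"

text \<open>The intersection with \<open>verts H\<close> makes the empty intersection (the case \<open>E = edges H\<close>)
  equal to \<open>H\<^sup>\<bullet>\<close> rather than to the whole type.\<close>

definition ero_v :: "('v, 'e) hypergraph \<Rightarrow> 'e set \<Rightarrow> 'v set" where
  "ero_v H E = verts H \<inter> (\<Inter>e\<in>edges H - E. verts H - ends H e)"

definition ero_e :: "('v, 'e) hypergraph \<Rightarrow> 'v set \<Rightarrow> 'e set" where
  "ero_e H V = {e \<in> edges H. ends H e \<subseteq> V}"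

definition dil_e :: "('v, 'e) hypergraph \<Rightarrow> 'v set \<Rightarrow> 'e set" where
  "dil_e H V = {e \<in> edges H. ends H e \<inter> V \<noteq> {}}"

definition dilation :: "('v, 'e) hypergraph \<Rightarrow> 'v set \<times> 'e set \<Rightarrow> 'v set \<times> 'e set" where
  "dilation H = map_prod (dil_v H \<circ> dil_e H) (dil_e H \<circ> dil_v H)"

definition erosion :: "('v, 'e) hypergraph \<Rightarrow> 'v set \<times> 'e set \<Rightarrow> 'v set \<times> 'e set" where
  "erosion H = map_prod (ero_v H \<circ> ero_e H) (ero_e H \<circ> ero_v H)"

definition half_opening :: "('v, 'e) hypergraph \<Rightarrow> 'v set \<times> 'e set \<Rightarrow> 'v set \<times> 'e set" where
  "half_opening H = map_prod (dil_v H \<circ> ero_e H) (dil_e H \<circ> ero_v H)"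

definition half_closing :: "('v, 'e) hypergraph \<Rightarrow> 'v set \<times> 'e set \<Rightarrow> 'v set \<times> 'e set" where
  "half_closing H = map_prod (ero_v H \<circ> dil_e H) (ero_e H \<circ> dil_v H)"

text \<open>The argument \<open>l\<close> stands for the index \<open>l/2\<close>; \<open>l = 2 * i + j\<close> with \<open>j \<in> {0, 1}\<close> means
  \<open>i = l div 2\<close> and \<open>j = l mod 2\<close>.\<close>

definition hg_opening ::
  "('v, 'e) hypergraph \<Rightarrow> nat \<Rightarrow> 'v set \<times> 'e set \<Rightarrow> 'v set \<times> 'e set" where
  "hg_opening H l =
     (dilation H ^^ (l div 2)) \<circ> (half_opening H ^^ (l mod 2)) \<circ> (erosion H ^^ (l div 2))"

definition hg_closing ::
  "('v, 'e) hypergraph \<Rightarrow> nat \<Rightarrow> 'v set \<times> 'e set \<Rightarrow> 'v set \<times> 'e set" where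
  "hg_closing H l =
     (erosion H ^^ (l div 2)) \<circ> (half_closing H ^^ (l mod 2)) \<circ> (dilation H ^^ (l div 2))"

definition opening_on :: "'a::order set \<Rightarrow> ('a \<Rightarrow> 'a) \<Rightarrow> bool" where
  "opening_on A f \<longleftrightarrow>
     f \<in> A \<rightarrow> A \<and> mono_on A f \<and> (\<forall>x\<in>A. f (f x) = f x) \<and> (\<forall>x\<in>A. f x \<le> x)"

definition closing_on :: "'a::order set \<Rightarrow> ('a \<Rightarrow> 'a) \<Rightarrow> bool" where
  "closing_on A f \<longleftrightarrow>
     f \<in> A \<rightarrow> A \<and> mono_on A f \<and> (\<forall>x\<in>A. f (f x) = f x) \<and> (\<forall>x\<in>A. x \<le> f x)"

definition granulometry_on :: "'a::order set \<Rightarrow> (nat \<Rightarrow> 'a \<Rightarrow> 'a) \<Rightarrow> bool" where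
  "granulometry_on A f \<longleftrightarrow>
     (\<forall>l. opening_on A (f l)) \<and> (\<forall>l m. l \<le> m \<longrightarrow> (\<forall>x\<in>A. f m x \<le> f l x))"

definition closing_granulometry_on :: "'a::order set \<Rightarrow> (nat \<Rightarrow> 'a \<Rightarrow> 'a) \<Rightarrow> bool" where
  "closing_granulometry_on A f \<longleftrightarrow>
     (\<forall>l. closing_on A (f l)) \<and> (\<forall>l m. l \<le> m \<longrightarrow> (\<forall>x\<in>A. f l x \<le> f m x))"

end

theory Submission imports Defs begin

text \<open>Dilation \<open>D\<close> and erosion \<open>E\<close> form an adjunction on subhypergraphs, and the half opening
  \<open>h\<close> is an opening squeezed between \<open>D \<circ> E\<close> and the identity. Hence
  \<open>D\<^sup>i \<circ> E\<^sup>i \<ge> D\<^sup>i \<circ> h \<circ> E\<^sup>i \<ge> D\<^sup>i \<circ> (D \<circ> E) \<circ> E\<^sup>i = D\<^bsup>i+1\<^esup> \<circ> E\<^bsup>i+1\<^esup>\<close>,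
  and \<open>D\<^sup>i \<circ> h \<circ> E\<^sup>i\<close> is idempotent because \<open>E\<^sup>i \<circ> D\<^sup>i\<close> is extensive. The closings are the same
  situation for the reversed inclusion, with \<open>D\<close> and \<open>E\<close>
  exchanged, so the argument is carried out for an arbitrary partial order.\<close>

locale half_step_adjunction =
  fixes le :: "'a \<Rightarrow> 'a \<Rightarrow> bool" (infix \<open>\<sqsubseteq>\<close> 50)
    and A :: "'a set" and D E h :: "'a \<Rightarrow> 'a"
  assumes refl: "x \<sqsubseteq> x"
    and trans: "x \<sqsubseteq> y \<Longrightarrow> y \<sqsubseteq> z \<Longrightarrow> x \<sqsubseteq> z"
    and antisym: "x \<sqsubseteq> y \<Longrightarrow> y \<sqsubseteq> x \<Longrightarrow> x = y"
    and D_closed: "x \<in> A \<Longrightarrow> D x \<in> A"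
    and E_closed: "x \<in> A \<Longrightarrow> E x \<in> A"
    and h_closed: "x \<in> A \<Longrightarrow> h x \<in> A"
    and D_mono: "x \<in> A \<Longrightarrow> y \<in> A \<Longrightarrow> x \<sqsubseteq> y \<Longrightarrow> D x \<sqsubseteq> D y"
    and E_mono: "x \<in> A \<Longrightarrow> y \<in> A \<Longrightarrow> x \<sqsubseteq> y \<Longrightarrow> E x \<sqsubseteq> E y"
    and h_mono: "x \<in> A \<Longrightarrow> y \<in> A \<Longrightarrow> x \<sqsubseteq> y \<Longrightarrow> h x \<sqsubseteq> h y"
    and DE_le: "x \<in> A \<Longrightarrow> D (E x) \<sqsubseteq> x"
    and le_ED: "x \<in> A \<Longrightarrow> x \<sqsubseteq> E (D x)"
    and h_le: "x \<in> A \<Longrightarrow> h x \<sqsubseteq> x"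
    and h_idem: "x \<in> A \<Longrightarrow> h (h x) = h x"
    and DE_le_h: "x \<in> A \<Longrightarrow> D (E x) \<sqsubseteq> h x"
begin

section \<open>Iterates of an adjoint pair\<close>

lemma funpow_closed:
  assumes "\<And>x. x \<in> A \<Longrightarrow> f x \<in> A" "x \<in> A"
  shows "(f ^^ n) x \<in> A"
  by (induction n) (simp_all add: assms)

lemma funpow_mono_on:
  assumes "\<And>x. x \<in> A \<Longrightarrow> f x \<in> A"
    and "\<And>x y. x \<in> A \<Longrightarrow> y \<in> A \<Longrightarrow> x \<sqsubseteq> y \<Longrightarrow> f x \<sqsubseteq> f y"
    and "x \<in> A" "y \<in> A" "x \<sqsubseteq> y"
  shows "(f ^^ n) x \<sqsubseteq> (f ^^ n) y"
  by (induction n) (simp_all add: assms funpow_closed)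

lemmas D_pow_closed = funpow_closed[of D, OF D_closed]
  and E_pow_closed = funpow_closed[of E, OF E_closed]
  and h_pow_closed = funpow_closed[of h, OF h_closed]
  and D_pow_mono = funpow_mono_on[of D, OF D_closed D_mono]
  and E_pow_mono = funpow_mono_on[of E, OF E_closed E_mono]
  and h_pow_mono = funpow_mono_on[of h, OF h_closed h_mono]

lemmas pow_closed = D_pow_closed E_pow_closed h_pow_closed

text \<open>The innermost \<open>D (E _)\<close> cancels first: \<open>DE_le\<close> at
  \<open>(E ^^ n) x\<close>, pushed through the monotone \<open>D ^^ n\<close>, leads back to the
  case \<open>n\<close>.\<close>

lemma DE_pow_le: "x \<in> A \<Longrightarrow> (D ^^ n) ((E ^^ n) x) \<sqsubseteq> x"
proof (induction n)
  case (Suc n)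
  have "(D ^^ n) (D (E ((E ^^ n) x))) \<sqsubseteq> (D ^^ n) ((E ^^ n) x)"
    using Suc.prems by (intro D_pow_mono DE_le D_closed E_closed pow_closed)
  then have "(D ^^ n) (D (E ((E ^^ n) x))) \<sqsubseteq> x"
    by (rule trans[OF _ Suc.IH[OF Suc.prems]])
  \<comment> \<open>Unfolding \<open>D ^^ Suc n\<close> puts the new \<open>D\<close> outermost;
    \<open>funpow_swap1\<close> moves it inside, next to \<open>E\<close>.\<close>
  then show ?case
    by (simp add: funpow_swap1)
qed (simp add: refl)

lemma le_ED_pow: "x \<in> A \<Longrightarrow> x \<sqsubseteq> (E ^^ n) ((D ^^ n) x)"
proof (induction n)
  case (Suc n)
  have "(E ^^ n) ((D ^^ n) x) \<sqsubseteq> (E ^^ n) (E (D ((D ^^ n) x)))"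
    using Suc.prems by (intro E_pow_mono le_ED D_closed E_closed pow_closed)
  with Suc.IH[OF Suc.prems] have "x \<sqsubseteq> (E ^^ n) (E (D ((D ^^ n) x)))"
    by (rule trans)
  then show ?case
    by (simp add: funpow_swap1)
qed (simp add: refl)

section \<open>The granulometry of an adjunction with a half step\<close>

definition G :: "nat \<Rightarrow> 'a \<Rightarrow> 'a" where
  "G l = (D ^^ (l div 2)) \<circ> (h ^^ (l mod 2)) \<circ> (E ^^ (l div 2))"

lemma h_pow_mod_two: "h ^^ (l mod 2) = id \<or> h ^^ (l mod 2) = h"
  by (cases "even l") (auto simp: even_iff_mod_2_eq_zero odd_iff_mod_2_eq_one)

lemma h_pow_le: "x \<in> A \<Longrightarrow> (h ^^ (l mod 2)) x \<sqsubseteq> x"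
  using h_pow_mod_two[of l] h_le refl by auto

lemma h_pow_idem: "x \<in> A \<Longrightarrow> (h ^^ (l mod 2)) ((h ^^ (l mod 2)) x) = (h ^^ (l mod 2)) x"
  using h_pow_mod_two[of l] h_idem by auto

lemma G_closed: "x \<in> A \<Longrightarrow> G l x \<in> A"
  by (simp add: G_def pow_closed)

lemma G_mono: "x \<in> A \<Longrightarrow> y \<in> A \<Longrightarrow> x \<sqsubseteq> y \<Longrightarrow> G l x \<sqsubseteq> G l y"
  by (simp add: G_def pow_closed D_pow_mono E_pow_mono h_pow_mono)

lemma G_le:
  assumes "x \<in> A"
  shows "G l x \<sqsubseteq> x"
proof -
  have "G l x \<sqsubseteq> (D ^^ (l div 2)) ((E ^^ (l div 2)) x)"
    using assms by (simp add: G_def pow_closed D_pow_mono h_pow_le)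
  then show ?thesis
    using DE_pow_le[OF assms] by (rule trans)
qed

lemma G_idem:
  assumes "x \<in> A"
  shows "G l (G l x) = G l x"
proof (rule antisym)
  show "G l (G l x) \<sqsubseteq> G l x"
    using assms by (intro G_le G_closed)
  \<comment> \<open>The middle stage of \<open>G l x\<close>, so that
    \<open>G l x = (D ^^ (l div 2)) y\<close>. As \<open>y\<close> is fixed by
    \<open>h ^^ (l mod 2)\<close>, extensivity of the iterated \<open>E \<circ> D\<close> at
    \<open>y\<close> survives applying that power.\<close>
  define y where "y = (h ^^ (l mod 2)) ((E ^^ (l div 2)) x)"
  have y: "y \<in> A" and hy: "(h ^^ (l mod 2)) y = y"
    using assms by (simp_all add: y_def pow_closed h_pow_idem)
  have "(h ^^ (l mod 2)) y \<sqsubseteq> (h ^^ (l mod 2)) ((E ^^ (l div 2)) ((D ^^ (l div 2)) y))"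
    using y by (intro h_pow_mono le_ED_pow pow_closed)
  then have "(D ^^ (l div 2)) y \<sqsubseteq> G l ((D ^^ (l div 2)) y)"
    using y by (simp add: G_def hy D_pow_mono pow_closed)
  then show "G l x \<sqsubseteq> G l (G l x)"
    by (simp add: G_def y_def)
qed

text \<open>From \<open>2 * i\<close> to \<open>2 * i + 1\<close> an \<open>h\<close> is inserted
  between the powers, which can only shrink the result; from there to \<open>2 * i + 2\<close> this
  \<open>h\<close> is replaced by the smaller \<open>D \<circ> E\<close>.\<close>

lemma G_Suc_le:
  assumes "x \<in> A"
  shows "G (Suc l) x \<sqsubseteq> G l x"
proof (cases "even l")
  case True
  then obtain i where l: "l = 2 * i"
    by (elim evenE)
  have "(D ^^ i) (h ((E ^^ i) x)) \<sqsubseteq> (D ^^ i) ((E ^^ i) x)"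
    using assms by (intro D_pow_mono h_le h_closed pow_closed)
  then show ?thesis
    by (simp add: G_def l)
next
  case False
  then obtain i where l: "l = 2 * i + 1"
    by (elim oddE)
  have "(D ^^ i) (D (E ((E ^^ i) x))) \<sqsubseteq> (D ^^ i) (h ((E ^^ i) x))"
    using assms by (intro D_pow_mono DE_le_h D_closed E_closed h_closed pow_closed)
  then show ?thesis
    by (simp add: G_def l funpow_swap1)
qed

lemma G_antimono:
  assumes "x \<in> A" "l \<le> m"
  shows "G m x \<sqsubseteq> G l x"
  using assms(2)
proof (induction m rule: dec_induct)
  case base
  show ?case by (rule refl)
next
  case (step m)
  with G_Suc_le[OF assms(1)] show ?case by (blast intro: trans)
qed

end

section \<open>Adjunctions between vertex sets and edge sets\<close>

lemma dil_v_mono: "E \<subseteq> E' \<Longrightarrow> dil_v H E \<subseteq> dil_v H E'"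
  by (auto simp: dil_v_def)

lemma dil_e_mono: "V \<subseteq> V' \<Longrightarrow> dil_e H V \<subseteq> dil_e H V'"
  by (auto simp: dil_e_def)

lemma ero_v_mono: "E \<subseteq> E' \<Longrightarrow> ero_v H E \<subseteq> ero_v H E'"
  by (auto simp: ero_v_def)

lemma ero_e_mono: "V \<subseteq> V' \<Longrightarrow> ero_e H V \<subseteq> ero_e H V'"
  by (auto simp: ero_e_def)

lemmas dil_ero_mono = dil_v_mono dil_e_mono ero_v_mono ero_e_mono

lemma dil_e_subset_edges: "dil_e H V \<subseteq> edges H"
  by (auto simp: dil_e_def)

lemma ero_e_subset_edges: "ero_e H V \<subseteq> edges H"
  by (auto simp: ero_e_def)

lemma ero_v_subset_verts: "ero_v H E \<subseteq> verts H"
  by (auto simp: ero_v_def)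

lemma dil_v_subset_verts: "is_hypergraph H \<Longrightarrow> E \<subseteq> edges H \<Longrightarrow> dil_v H E \<subseteq> verts H"
  by (auto simp: is_hypergraph_def dil_v_def)

text \<open>Counit of the adjunction with left adjoint \<open>dil_v\<close> and right adjoint
  \<open>ero_e\<close>; the next lemma is its unit.\<close>

lemma dil_v_ero_e_subset: "dil_v H (ero_e H V) \<subseteq> V"
  by (auto simp: dil_v_def ero_e_def)

lemma subset_ero_e_dil_v: "E \<subseteq> edges H \<Longrightarrow> E \<subseteq> ero_e H (dil_v H E)"
  by (auto simp: dil_v_def ero_e_def)

text \<open>Counit of the second adjunction, \<open>dil_e\<close> with \<open>ero_v\<close>:
  \<open>ero_v H E\<close> avoids every edge outside \<open>E\<close>, so an edge meeting it lies in
  \<open>E\<close>. The unit follows.\<close>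

lemma dil_e_ero_v_subset: "dil_e H (ero_v H E) \<subseteq> E"
  by (auto simp: dil_e_def ero_v_def)

lemma subset_ero_v_dil_e: "V \<subseteq> verts H \<Longrightarrow> V \<subseteq> ero_v H (dil_e H V)"
  by (auto simp: dil_e_def ero_v_def)

text \<open>Phrasing the incidence condition through \<open>dil_v\<close> lets closure under the
  operators be shown by monotonicity, units and counits.\<close>

lemma subhypergraphs_iff:
  "(V, E) \<in> subhypergraphs H \<longleftrightarrow> V \<subseteq> verts H \<and> E \<subseteq> edges H \<and> dil_v H E \<subseteq> V"
  by (auto simp: subhypergraphs_def dil_v_def)

lemma subhypergraphs_subset_ero_e: "(V, E) \<in> subhypergraphs H \<Longrightarrow> E \<subseteq> ero_e H V"
  by (auto simp: subhypergraphs_def ero_e_def)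

text \<open>The counit gives one inclusion, \<open>dil_v\<close> applied to the unit at
  \<open>ero_e H V\<close> the other. The next three lemmas follow the same pattern.\<close>

lemma dil_v_ero_e_idem:
  "dil_v H (ero_e H (dil_v H (ero_e H V))) = dil_v H (ero_e H V)"
  by (intro antisym dil_v_ero_e_subset dil_v_mono subset_ero_e_dil_v ero_e_subset_edges)

lemma dil_e_ero_v_idem:
  "dil_e H (ero_v H (dil_e H (ero_v H E))) = dil_e H (ero_v H E)"
  by (intro antisym dil_e_ero_v_subset dil_e_mono subset_ero_v_dil_e ero_v_subset_verts)

lemma ero_e_dil_v_idem:
  assumes "E \<subseteq> edges H"
  shows "ero_e H (dil_v H (ero_e H (dil_v H E))) = ero_e H (dil_v H E)"
  using assms
  by (intro antisym ero_e_mono dil_v_ero_e_subset dil_v_mono subset_ero_e_dil_v)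

lemma ero_v_dil_e_idem:
  assumes "V \<subseteq> verts H"
  shows "ero_v H (dil_e H (ero_v H (dil_e H V))) = ero_v H (dil_e H V)"
  using assms
  by (intro antisym ero_v_mono dil_e_ero_v_subset dil_e_mono subset_ero_v_dil_e)

section \<open>Operators on subhypergraphs\<close>

lemma erosion_closed:
  assumes "X \<in> subhypergraphs H"
  shows "erosion H X \<in> subhypergraphs H"
proof (cases X)
  case (Pair V E)
  with assms have "E \<subseteq> ero_e H V"
    by (simp add: subhypergraphs_subset_ero_e)
  then have "dil_v H (ero_e H (ero_v H E)) \<subseteq> ero_v H (ero_e H V)"
    by (intro subset_trans[OF dil_v_ero_e_subset] ero_v_mono)
  then show ?thesis
    by (simp add: Pair erosion_def subhypergraphs_iff ero_v_subset_verts ero_e_subset_edges)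
qed

text \<open>The set \<open>V\<close> separates the two sides: the counit and
  \<open>dil_v H E \<subseteq> V\<close> bound the left one, the unit at \<open>V\<close> the right
  one.\<close>

lemma half_closing_closed:
  assumes "X \<in> subhypergraphs H"
  shows "half_closing H X \<in> subhypergraphs H"
proof (cases X)
  case (Pair V E)
  with assms have V: "V \<subseteq> verts H" and E: "dil_v H E \<subseteq> V"
    by (simp_all add: subhypergraphs_iff)
  have "dil_v H (ero_e H (dil_v H E)) \<subseteq> ero_v H (dil_e H V)"
    using dil_v_ero_e_subset E subset_ero_v_dil_e[OF V] by (rule subset_trans[OF subset_trans])
  then show ?thesis
    by (simp add: Pair half_closing_def subhypergraphs_iff ero_v_subset_verts ero_e_subset_edges)
qed

lemma operators_mono:
  assumes "X \<le> Y"
  shows "dilation H X \<le> dilation H Y" "erosion H X \<le> erosion H Y"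
    "half_opening H X \<le> half_opening H Y" "half_closing H X \<le> half_closing H Y"
  using assms
  by (cases X; cases Y; simp add: dilation_def erosion_def half_opening_def half_closing_def
      dil_ero_mono)+

text \<open>In each component the inner dilation and erosion cancel by a counit:
  \<open>dil_e \<circ> ero_v\<close> for vertices, \<open>dil_v \<circ> ero_e\<close> for edges. The
  outer pair left over is the half opening.\<close>

lemma dilation_erosion_le_half_opening: "dilation H (erosion H X) \<le> half_opening H X"
  by (cases X) (simp add: dilation_def erosion_def half_opening_def dil_ero_mono
      dil_e_ero_v_subset dil_v_ero_e_subset)

lemma half_opening_le: "half_opening H X \<le> X"
  by (cases X) (simp add: half_opening_def dil_e_ero_v_subset dil_v_ero_e_subset)

lemma half_opening_idem: "half_opening H (half_opening H X) = half_opening H X"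
  by (cases X) (simp add: half_opening_def dil_v_ero_e_idem dil_e_ero_v_idem)

lemma le_half_closing: "X \<in> subhypergraphs H \<Longrightarrow> X \<le> half_closing H X"
  by (cases X) (simp add: subhypergraphs_iff half_closing_def subset_ero_e_dil_v
      subset_ero_v_dil_e)

lemma half_closing_idem:
  "X \<in> subhypergraphs H \<Longrightarrow> half_closing H (half_closing H X) = half_closing H X"
  by (cases X) (simp add: subhypergraphs_iff half_closing_def ero_e_dil_v_idem ero_v_dil_e_idem)

lemma dilation_erosion_le: "dilation H (erosion H X) \<le> X"
  using dilation_erosion_le_half_opening half_opening_le by (rule order_trans)

context
  fixes H :: "('v, 'e) hypergraph"
  assumes H: "is_hypergraph H"
begin

lemma dilation_closed:
  assumes "X \<in> subhypergraphs H"
  shows "dilation H X \<in> subhypergraphs H"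
  using assms H
  by (cases X) (simp add: dilation_def subhypergraphs_iff dil_v_subset_verts
      dil_e_subset_edges dil_ero_mono)

text \<open>The counit bounds \<open>dil_e H (ero_v H E)\<close> by \<open>E\<close>, and
  \<open>E \<subseteq> ero_e H V\<close> is the adjoint form of the incidence condition.\<close>

lemma half_opening_closed:
  assumes "X \<in> subhypergraphs H"
  shows "half_opening H X \<in> subhypergraphs H"
proof (cases X)
  case (Pair V E)
  with assms have "E \<subseteq> ero_e H V"
    by (simp add: subhypergraphs_subset_ero_e)
  then have "dil_v H (dil_e H (ero_v H E)) \<subseteq> dil_v H (ero_e H V)"
    by (intro dil_v_mono subset_trans[OF dil_e_ero_v_subset])
  then show ?thesis
    using H by (simp add: Pair half_opening_def subhypergraphs_iff dil_v_subset_verts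
        ero_e_subset_edges dil_e_subset_edges)
qed

text \<open>A unit is inserted in the middle of each component. For edges this is the unit at
  \<open>dil_v H E\<close>, which lies in \<open>verts H\<close> because \<open>H\<close> is a
  hypergraph.\<close>

lemma half_closing_le_erosion_dilation:
  assumes "X \<in> subhypergraphs H"
  shows "half_closing H X \<le> erosion H (dilation H X)"
  using assms H
  by (cases X) (simp add: subhypergraphs_iff dilation_def erosion_def half_closing_def
      dil_ero_mono subset_ero_e_dil_v subset_ero_v_dil_e dil_e_subset_edges dil_v_subset_verts)

lemma le_erosion_dilation: "X \<in> subhypergraphs H \<Longrightarrow> X \<le> erosion H (dilation H X)"
  by (rule order_trans[OF le_half_closing half_closing_le_erosion_dilation])

section \<open>Transfer to the openings and closings\<close>

interpretation op: half_step_adjunction "(\<le>)" "subhypergraphs H" "dilation H" "erosion H"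
  "half_opening H"
  by unfold_locales
    (erule (1) order_trans | drule (1) order_trans, assumption |
      simp add: dilation_closed erosion_closed half_opening_closed operators_mono
      dilation_erosion_le le_erosion_dilation half_opening_le half_opening_idem
      dilation_erosion_le_half_opening)+

text \<open>For the reversed order erosion is the left adjoint: \<open>DE_le\<close> becomes
  \<open>le_erosion_dilation\<close>, \<open>le_ED\<close> becomes
  \<open>dilation_erosion_le\<close>, and the openings \<open>G\<close> turn into the closings
  \<open>hg_closing H\<close>.\<close>

interpretation cl: half_step_adjunction "(\<ge>)" "subhypergraphs H" "erosion H" "dilation H"
  "half_closing H"
  by unfold_locales
    (erule (1) order_trans | drule (1) order_trans, assumption |
      simp add: dilation_closed erosion_closed half_closing_closed operators_mono
      dilation_erosion_le le_erosion_dilation le_half_closing half_closing_idem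
      half_closing_le_erosion_dilation)+

lemma granulometry_on_hg_opening: "granulometry_on (subhypergraphs H) (hg_opening H)"
proof -
  have "hg_opening H = op.G"
    by (simp add: fun_eq_iff hg_opening_def op.G_def)
  then show ?thesis
    by (auto simp: granulometry_on_def opening_on_def op.G_idem
        intro: op.G_closed op.G_le op.G_antimono intro!: mono_onI op.G_mono)
qed

lemma closing_granulometry_on_hg_closing:
  "closing_granulometry_on (subhypergraphs H) (hg_closing H)"
proof -
  have "hg_closing H = cl.G"
    by (simp add: fun_eq_iff hg_closing_def cl.G_def)
  then show ?thesis
    by (auto simp: closing_granulometry_on_def closing_on_def cl.G_idem
        intro: cl.G_closed cl.G_le cl.G_antimono intro!: mono_onI cl.G_mono)
qed

end

theorem theorem3:
  fixes H :: "('v, 'e) hypergraph"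
  assumes "is_hypergraph H"
  shows "granulometry_on (subhypergraphs H) (hg_opening H) \<and>
         closing_granulometry_on (subhypergraphs H) (hg_closing H)"
  using assms by (simp add: granulometry_on_hg_opening closing_granulometry_on_hg_closing)

end
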